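(* A Minkowski plane $(M,\|\cdot\|)$ is Euclidean if and only if for any $\mathcal{C}$-orthocentric system $\{p_1,p_2,p_3,p_4\}$ (with $p_1,p_2,p_3$ non-collinear, so that the bisector below is defined), $p_4$ lies on the line containing the Busemann angular bisector $A_B\big([p_3,p_1\rangle,[p_3,p_2\rangle\big)$ whenever $\|p_3-p_1\|=\|p_3-p_2\|$.
   Context: A Minkowski plane is a real two-dimensional normed linear space; it is Euclidean if its norm is induced by an inner product. For $x\neq y$, $[x,y\rangle$ denotes the ray with starting point $x$ passing through $y$. For non-collinear rays $[p,a\rangle$ and $[p,b\rangle$, the Busemann angular bisector $A_B([p,a\rangle,[p,b\rangle)$ is the ray $\left[p,\ p+\frac12\left(\frac{a-p}{\|a-p\|}+\frac{b-p}{\|b-p\|}\right)\right\rangle$. $S_p(w)=2p-w$ is the symmetry with center $p$. For points $a,b,c\in M$, the set of circumcenters is $\mathcal{C}(\triangle abc)=\{x\in M:\|x-a\|=\|x-b\|=\|x-c\|\}$. $\mathcal{C}$-orthocenter: given points $a,b,c\in M$ and $o\in\mathcal{C}(\triangle abc)$, put $q=\frac{a+b+c-o}{2}$, which is the point of symmetry between $\triangle abc$ and the triangle whose vertices are the images of $o$ under the symmetries at the midpoints of the sides $[b,c],[a,c],[a,b]$. The $\mathcal{C}$-orthocenter of $\triangle abc$ associated with $o$ is $S_q(o)=a+b+c-2o$. $\mathcal{C}$-orthocentric system: four points $p_1,p_2,p_3,p_4\in M$ form a $\mathcal{C}$-orthocentric system $\{p_1,p_2,p_3,p_4\}$ if for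 some labeling $\{i,j,k,l\}=\{1,2,3,4\}$ there is a circumcenter $x_i\in\mathcal{C}(\triangle p_jp_kp_l)$ such that $p_i$ is the $\mathcal{C}$-orthocenter of $\triangle p_jp_kp_l$ associated with $x_i$. *)

theory Defs
  imports "HOL-Analysis.Analysis"
begin

definition is_inner_product :: "('a::real_vector \<Rightarrow> 'a \<Rightarrow> real) \<Rightarrow> bool" where
  "is_inner_product B \<longleftrightarrow>
     bilinear B \<and> (\<forall>x y. B x y = B y x) \<and> (\<forall>x. x \<noteq> 0 \<longrightarrow> B x x > 0)"

definition induced_by_inner_product :: "('a::real_vector \<Rightarrow> real) \<Rightarrow> bool" where
  "induced_by_inner_product N \<longleftrightarrow>
     (\<exists>B. is_inner_product B \<and> (\<forall>x. N x = sqrt (B x x)))"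

definition ray :: "'a::real_vector \<Rightarrow> 'a \<Rightarrow> 'a set" where
  "ray x y = {x + t *\<^sub>R (y - x) | t. t \<ge> 0}"

text \<open>Bisector of the rays \<open>[p,a\<rangle>\<close> and \<open>[p,b\<rangle>\<close>; only meaningful when \<open>p, a, b\<close> are
  not collinear. It depends on \<open>a\<close> and \<open>b\<close> only through the rays they span.\<close>

definition busemann_bisector :: "'a::real_normed_vector \<Rightarrow> 'a \<Rightarrow> 'a \<Rightarrow> 'a set" where
  "busemann_bisector p a b =
     ray p (p + (1/2) *\<^sub>R ((a - p) /\<^sub>R norm (a - p) + (b - p) /\<^sub>R norm (b - p)))"

definition point_symmetry :: "'a::real_vector \<Rightarrow> 'a \<Rightarrow> 'a" where
  "point_symmetry p w = 2 *\<^sub>R p - w"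

definition circumcenters :: "'a::real_normed_vector \<Rightarrow> 'a \<Rightarrow> 'a \<Rightarrow> 'a set" where
  "circumcenters a b c = {x. norm (x - a) = norm (x - b) \<and> norm (x - b) = norm (x - c)}"

definition symmetry_center :: "'a::real_vector \<Rightarrow> 'a \<Rightarrow> 'a \<Rightarrow> 'a \<Rightarrow> 'a" where
  "symmetry_center a b c z = (a + b + c - z) /\<^sub>R 2"

lemma point_symmetry_symmetry_center:
  "point_symmetry (symmetry_center a b c z) a = point_symmetry (midpoint b c) z"
  "point_symmetry (symmetry_center a b c z) b = point_symmetry (midpoint a c) z"
  "point_symmetry (symmetry_center a b c z) c = point_symmetry (midpoint a b) z"
  by (simp_all add: point_symmetry_def symmetry_center_def midpoint_def)

text \<open>The intended use is with \<open>z\<close> in \<open>circumcenters a b c\<close>.\<close>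

definition C_orthocenter :: "'a::real_vector \<Rightarrow> 'a \<Rightarrow> 'a \<Rightarrow> 'a \<Rightarrow> 'a" where
  "C_orthocenter a b c z = point_symmetry (symmetry_center a b c z) z"

lemma C_orthocenter_eq: "C_orthocenter a b c z = a + b + c - 2 *\<^sub>R z"
  by (simp add: C_orthocenter_def point_symmetry_def symmetry_center_def scaleR_2)

text \<open>The four points are \<open>p 1, p 2, p 3, p 4\<close>, not necessarily distinct; other values of
  \<open>p\<close> are irrelevant.\<close>

definition C_orthocentric_system :: "(nat \<Rightarrow> 'a::real_normed_vector) \<Rightarrow> bool" where
  "C_orthocentric_system p \<longleftrightarrow>
     (\<exists>i j k l. {i, j, k, l} = {1, 2, 3, 4} \<and>
        (\<exists>x \<in> circumcenters (p j) (p k) (p l). p i = C_orthocenter (p j) (p k) (p l) x))"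

end

theory Submission
  imports Defs
begin

text \<open>In a Euclidean plane the differences \<open>p 4 - p 3\<close> and \<open>p 1 - p 2\<close> of a
  \<open>C\<close>-orthocentric system are orthogonal, and so are \<open>p 1 + p 2 - 2 p 3\<close> and \<open>p 1 - p 2\<close> when
  \<open>p 3\<close> is equidistant from \<open>p 1\<close> and \<open>p 2\<close>.

  Conversely, taking the circumcenter as origin, the bisector condition says that \<open>x + y\<close> is parallel
  to \<open>z\<close> whenever \<open>x, y, z\<close> lie on a sphere around the origin and \<open>z\<close> is equidistant from \<open>x\<close> and
  \<open>y\<close>. Along a line \<open>g t = norm (a + t c)\<close> with \<open>norm c = 1\<close> this implies that \<open>g s = g t = r\<close> with
  \<open>s < t\<close> forces \<open>g (s - r) = g (t + r)\<close>. Iterating moves a chord to infinity without moving its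
  midpoint, while the limits of \<open>g t - t\<close> and \<open>g (- t) - t\<close> determine that midpoint: all chords on
  the line have the same one. Hence \<open>g\<close> is symmetric, which is Ficken's criterion
  \<open>norm x = norm y \<Longrightarrow> norm (\<alpha> x + \<beta> y) = norm (\<beta> x + \<alpha> y)\<close>. Starting from unit vectors
  \<open>a, c\<close> with \<open>norm (a + c) = norm (a - c)\<close>, comparing the midpoints of two chords of a line parallel
  to a unit vector \<open>\<alpha> a + \<beta> c\<close> gives \<open>\<alpha>\<^sup>2 + \<beta>\<^sup>2 = 1\<close>.\<close>

section \<open>Limits of the norm along a line and midpoints of its chords\<close>

lemma antimono_tendsto_Inf_at_top:
  fixes f :: "real \<Rightarrow> real"
  assumes "antimono f" and "bdd_below (range f)"
  shows "(f \<longlongrightarrow> Inf (range f)) at_top"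
proof (rule decreasing_tendsto)
  show "eventually (\<lambda>t. Inf (range f) \<le> f t) at_top"
    using assms(2) by (simp add: cInf_lower)
next
  fix y assume "Inf (range f) < y"
  then obtain s where s: "f s < y"
    using cInf_lessD by blast
  show "eventually (\<lambda>t. f t < y) at_top"
    using eventually_ge_at_top[of s]
    by eventually_elim (use s assms(1) in \<open>force dest: antimonoD\<close>)
qed

text \<open>By the triangle inequality the function is antitone and bounded below by
  \<open>- norm a\<close>. Its limit is the Busemann function of the ray in direction
  \<open>- c\<close>, evaluated at \<open>a\<close>.\<close>

lemma norm_along_line_asymptotics:
  fixes a c :: "'a::real_normed_vector"
  assumes "norm c = 1"
  obtains l where "((\<lambda>t. norm (a + t *\<^sub>R c) - t) \<longlongrightarrow> l) at_top"
proof -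
  let ?f = "\<lambda>t. norm (a + t *\<^sub>R c) - t"
  have "antimono ?f"
  proof (rule antimonoI)
    fix s t :: real assume "s \<le> t"
    have "norm (a + t *\<^sub>R c) = norm ((a + s *\<^sub>R c) + (t - s) *\<^sub>R c)"
      by (simp add: algebra_simps)
    also have "\<dots> \<le> norm (a + s *\<^sub>R c) + (t - s)"
      using norm_triangle_ineq[of "a + s *\<^sub>R c" "(t - s) *\<^sub>R c"] assms \<open>s \<le> t\<close> by simp
    finally show "?f t \<le> ?f s" by simp
  qed
  moreover have "bdd_below (range ?f)"
  proof (rule bdd_belowI2)
    fix t :: real
    have "t \<le> norm (t *\<^sub>R c)" using assms by simp
    also have "\<dots> \<le> norm (a + t *\<^sub>R c) + norm a"
      using norm_triangle_ineq4[of "a + t *\<^sub>R c" a] by simp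
    finally show "- norm a \<le> ?f t" by simp
  qed
  ultimately show thesis
    using antimono_tendsto_Inf_at_top that by blast
qed

text \<open>A chord of the line through \<open>a\<close> in direction \<open>c\<close> joins two
  points of one sphere around the origin; \<open>\<sigma>\<close> is twice the parameter of its
  midpoint.\<close>

definition chord_sum :: "'a::real_normed_vector \<Rightarrow> 'a \<Rightarrow> real \<Rightarrow> bool" where
  "chord_sum a c \<sigma> \<longleftrightarrow>
     (\<exists>s t. s \<noteq> t \<and> norm (a + s *\<^sub>R c) = norm (a + t *\<^sub>R c) \<and> s + t = \<sigma>)"

lemma chord_sumI:
  "s \<noteq> t \<Longrightarrow> norm (a + s *\<^sub>R c) = norm (a + t *\<^sub>R c) \<Longrightarrow> chord_sum a c (s + t)"
  by (auto simp: chord_sum_def)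

text \<open>With \<open>g t = norm (a + t *\<^sub>R c)\<close>, a chord with ends at
  \<open>\<sigma> - T\<close> and \<open>T\<close> satisfies
  \<open>(g (\<sigma> - T) - (T - \<sigma>)) - (g T - T) = \<sigma>\<close>. Such chords exist for
  arbitrarily large \<open>T\<close>, and along them the left side tends to
  \<open>lm - lp\<close>.\<close>

lemma chord_sum_limit:
  fixes a c :: "'a::real_normed_vector"
  assumes extend: "\<And>x y :: 'a. norm x = norm y \<Longrightarrow> x + y \<noteq> 0 \<Longrightarrow>
      norm (x + (norm x / norm (x + y)) *\<^sub>R (x + y)) = norm (y + (norm x / norm (x + y)) *\<^sub>R (x + y))"
    and c: "norm c = 1" and "chord_sum a c \<sigma>"
    and lim_p: "((\<lambda>t. norm (a + t *\<^sub>R c) - t) \<longlongrightarrow> lp) at_top"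
    and lim_m: "((\<lambda>t. norm (a + t *\<^sub>R (- c)) - t) \<longlongrightarrow> lm) at_top"
  shows "\<sigma> = lm - lp"
proof -
  let ?g = "\<lambda>t. norm (a + t *\<^sub>R c)"
  obtain s t where "s \<noteq> t" "?g s = ?g t" and st: "s + t = \<sigma>"
    using \<open>chord_sum a c \<sigma>\<close> by (auto simp: chord_sum_def)
  define u where "u = max s t"
  have u: "u > \<sigma> - u" "?g (\<sigma> - u) = ?g u"
    using \<open>s \<noteq> t\<close> \<open>?g s = ?g t\<close> st by (auto simp: u_def max_def)
  \<comment> \<open>The upper ends of the chords obtained by extending the given one repeatedly; the midpoint
    stays at \<open>\<sigma> / 2\<close>.\<close>
  define T where "T n = ((\<lambda>v. v + ?g v) ^^ n) u" for n
  have T0: "T 0 = u" and TS: "T (Suc n) = T n + ?g (T n)" for n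
    by (simp_all add: T_def)
  have step: "?g (\<sigma> - (v + ?g v)) = ?g (v + ?g v)" "2 * ?g v \<ge> v - (\<sigma> - v)"
    if v: "v > \<sigma> - v" "?g (\<sigma> - v) = ?g v" for v
  proof -
    \<comment> \<open>Negating the lower end makes \<open>?x + ?y\<close> parallel to the line, so
      the vector added in \<open>extend\<close> moves both ends outwards along it by
      \<open>?g v\<close>.\<close>
    let ?x = "a + v *\<^sub>R c" and ?y = "- (a + (\<sigma> - v) *\<^sub>R c)"
    have xy: "?x + ?y = (2 * v - \<sigma>) *\<^sub>R c"
      by (simp add: algebra_simps scaleR_2 flip: scaleR_scaleR)
    have n: "norm ?x = norm ?y" using v(2) by (metis norm_minus_cancel)
    have nxy: "norm (?x + ?y) = 2 * v - \<sigma>" unfolding xy using v c by simp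
    have "?x + ?y \<noteq> 0" unfolding xy using v c by auto
    note e = extend[OF n this]
    have "(norm ?x / norm (?x + ?y)) *\<^sub>R (?x + ?y) = ?g v *\<^sub>R c"
      unfolding nxy unfolding xy using v by simp
    with e have "norm (?x + ?g v *\<^sub>R c) = norm (?y + ?g v *\<^sub>R c)" by simp
    moreover have "?x + ?g v *\<^sub>R c = a + (v + ?g v) *\<^sub>R c" by (simp add: algebra_simps)
    moreover have "?y + ?g v *\<^sub>R c = - (a + (\<sigma> - (v + ?g v)) *\<^sub>R c)"
      by (simp add: algebra_simps)
    ultimately show "?g (\<sigma> - (v + ?g v)) = ?g (v + ?g v)"
      by (metis norm_minus_cancel)
    show "2 * ?g v \<ge> v - (\<sigma> - v)"
      using norm_triangle_ineq[of ?x ?y] n nxy by simp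
  qed
  \<comment> \<open>Half the length of a chord is at most the radius \<open>?g (T n)\<close>, and
    the chords only grow, so each step gains at least \<open>u - \<sigma> / 2\<close>.\<close>
  have T: "T n > \<sigma> - T n \<and> ?g (\<sigma> - T n) = ?g (T n) \<and> T n \<ge> u + real n * (u - \<sigma> / 2)" for n
  proof (induction n)
    case 0
    then show ?case using u by (simp add: T0)
  next
    case (Suc n)
    have *: "u - \<sigma> / 2 > 0" using u by simp
    have "T n \<ge> u" using Suc * by (smt (verit) mult_nonneg_nonneg of_nat_0_le_iff)
    then have "?g (T n) \<ge> u - \<sigma> / 2"
      using step(2)[of "T n"] Suc by simp
    then have "T n + ?g (T n) \<ge> u + real n * (u - \<sigma> / 2) + (u - \<sigma> / 2)"
      using Suc by linarith
    moreover have "real (Suc n) * (u - \<sigma> / 2) = real n * (u - \<sigma> / 2) + (u - \<sigma> / 2)"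
      by (simp add: algebra_simps)
    moreover have "\<sigma> - (T n + ?g (T n)) < T n + ?g (T n)"
      using Suc norm_ge_zero[of "a + T n *\<^sub>R c"] by linarith
    ultimately show ?case
      using step(1)[of "T n"] Suc unfolding TS by simp
  qed
  have lim: "filterlim T at_top sequentially"
  proof (rule filterlim_at_top_mono)
    have "u - \<sigma> / 2 > 0" using u by simp
    then have "filterlim (\<lambda>n. (u - \<sigma> / 2) * real n) at_top sequentially"
      by (intro filterlim_tendsto_pos_mult_at_top[OF tendsto_const _ filterlim_real_sequentially])
    from filterlim_tendsto_add_at_top[OF tendsto_const[of u] this]
    show "filterlim (\<lambda>n. u + real n * (u - \<sigma> / 2)) at_top sequentially"
      by (simp add: mult.commute)
  qed (use T in auto)
  \<comment> \<open>\<open>- \<sigma> + T n\<close> is the parameter of the lower end, measured in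
    direction \<open>- c\<close>.\<close>
  have "filterlim (\<lambda>n. - \<sigma> + T n) at_top sequentially"
    by (rule filterlim_tendsto_add_at_top[OF tendsto_const lim])
  then have "(\<lambda>n. norm (a + (- \<sigma> + T n) *\<^sub>R (- c)) - (- \<sigma> + T n)) \<longlonglongrightarrow> lm"
    by (rule filterlim_compose[OF lim_m])
  moreover have "(\<lambda>n. ?g (T n) - T n) \<longlonglongrightarrow> lp"
    by (rule filterlim_compose[OF lim_p lim])
  ultimately have "(\<lambda>n. (norm (a + (- \<sigma> + T n) *\<^sub>R (- c)) - (- \<sigma> + T n)) - (?g (T n) - T n))
      \<longlonglongrightarrow> lm - lp"
    by (rule tendsto_diff)
  moreover have "norm (a + (- \<sigma> + T n) *\<^sub>R (- c)) = ?g (T n)" for n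
  proof -
    have "a + (- \<sigma> + T n) *\<^sub>R (- c) = a + (\<sigma> - T n) *\<^sub>R c" by (simp add: algebra_simps)
    with T[of n] show ?thesis by simp
  qed
  ultimately have "(\<lambda>n. \<sigma>) \<longlonglongrightarrow> lm - lp" by simp
  then show ?thesis by (simp add: LIMSEQ_const_iff)
qed

text \<open>\<open>lm - lp\<close> does not depend on the chord. Normalising \<open>c\<close>
  multiplies all sums by \<open>norm c\<close>, so the unit case suffices.\<close>

lemma chord_sum_unique:
  fixes a c :: "'a::real_normed_vector"
  assumes extend: "\<And>x y :: 'a. norm x = norm y \<Longrightarrow> x + y \<noteq> 0 \<Longrightarrow>
      norm (x + (norm x / norm (x + y)) *\<^sub>R (x + y)) = norm (y + (norm x / norm (x + y)) *\<^sub>R (x + y))"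
    and "c \<noteq> 0" and "chord_sum a c \<sigma>" "chord_sum a c \<tau>"
  shows "\<sigma> = \<tau>"
proof -
  let ?c = "c /\<^sub>R norm c"
  have c: "norm ?c = 1" "norm (- ?c) = 1" using \<open>c \<noteq> 0\<close> by simp_all
  have unit: "chord_sum a ?c (norm c * \<rho>)" if \<rho>: "chord_sum a c \<rho>" for \<rho>
  proof -
    obtain s t where "s \<noteq> t" "norm (a + s *\<^sub>R c) = norm (a + t *\<^sub>R c)" "s + t = \<rho>"
      using \<rho> unfolding chord_sum_def by blast
    then show ?thesis
      using chord_sumI[of "norm c * s" "norm c * t" a ?c] \<open>c \<noteq> 0\<close> by (auto simp: algebra_simps)
  qed
  obtain lp where lp: "((\<lambda>t. norm (a + t *\<^sub>R ?c) - t) \<longlongrightarrow> lp) at_top"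
    using norm_along_line_asymptotics[OF c(1)] by blast
  obtain lm where lm: "((\<lambda>t. norm (a + t *\<^sub>R (- ?c)) - t) \<longlongrightarrow> lm) at_top"
    using norm_along_line_asymptotics[OF c(2)] by blast
  have "norm c * \<rho> = lm - lp" if "chord_sum a c \<rho>" for \<rho>
    by (rule chord_sum_limit[OF _ c(1) unit[OF that] lp lm]) (erule (1) extend)
  then have "norm c * \<sigma> = norm c * \<tau>" using assms(3,4) by simp
  then show ?thesis using \<open>c \<noteq> 0\<close> by simp
qed

section \<open>Ficken's symmetry from the common midpoint\<close>

lemma norm_line_exceeds:
  fixes a c :: "'a::real_normed_vector"
  assumes "c \<noteq> 0"
  obtains M where "M > 0" "\<And>t. \<bar>t\<bar> \<ge> M \<Longrightarrow> norm (a + t *\<^sub>R c) \<ge> R"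
proof
  let ?M = "(norm a + \<bar>R\<bar>) / norm c + 1"
  show "?M > 0" by (simp add: add_nonneg_pos)
  fix t :: real assume "\<bar>t\<bar> \<ge> ?M"
  then have "\<bar>t\<bar> \<ge> (norm a + \<bar>R\<bar>) / norm c" by simp
  then have "\<bar>t\<bar> * norm c \<ge> norm a + \<bar>R\<bar>"
    using assms by (simp add: divide_le_eq)
  then show "norm (a + t *\<^sub>R c) \<ge> R"
    using norm_triangle_ineq4[of "a + t *\<^sub>R c" a] by simp
qed

text \<open>From \<open>s\<close> away from \<open>t\<close>, the norm starts below its value at
  \<open>t\<close> and grows beyond every bound, so it takes that value again on this side.\<close>

lemma chord_through:
  fixes a c :: "'a::real_normed_vector"
  assumes "c \<noteq> 0" and less: "norm (a + s *\<^sub>R c) < norm (a + t *\<^sub>R c)"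
  obtains v where "v \<noteq> t" "norm (a + v *\<^sub>R c) = norm (a + t *\<^sub>R c)"
proof -
  let ?g = "\<lambda>t. norm (a + t *\<^sub>R c)"
  obtain M where M: "M > 0" "\<And>v. \<bar>v\<bar> \<ge> M \<Longrightarrow> ?g v \<ge> ?g t"
    using norm_line_exceeds[OF \<open>c \<noteq> 0\<close>] by metis
  have cont: "continuous_on A ?g" for A by (intro continuous_intros)
  consider "s < t" | "t < s" using less by fastforce
  then show thesis
  proof cases
    case 1
    have "\<exists>v\<ge>min s (- M). v \<le> s \<and> ?g v = ?g t"
      by (rule IVT2'[OF _ _ _ cont]) (use less M in \<open>auto simp: min_def\<close>)
    then obtain v where "v \<le> s" "?g v = ?g t" by blast
    then show ?thesis using 1 that[of v] by linarith
  next
    case 2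
    have "\<exists>v\<ge>s. v \<le> max s M \<and> ?g v = ?g t"
      by (rule IVT'[OF _ _ _ cont]) (use less M in \<open>auto simp: max_def\<close>)
    then obtain v where "v \<ge> s" "?g v = ?g t" by blast
    then show ?thesis using 2 that[of v] by linarith
  qed
qed

text \<open>The chord from \<open>y\<close> to \<open>x\<close> has parameters 0 and 1, so every
  chord of this line has sum 1 and the norm is invariant under the reflection of \<open>t\<close> to
  \<open>1 - t\<close>. Scaling by \<open>\<alpha> + \<beta>\<close> gives the claim.\<close>

lemma Ficken_swap:
  fixes x y :: "'a::real_normed_vector"
  assumes unique: "\<And>(a::'a) c \<sigma> \<tau>. c \<noteq> 0 \<Longrightarrow> chord_sum a c \<sigma> \<Longrightarrow> chord_sum a c \<tau> \<Longrightarrow> \<sigma> = \<tau>"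
    and eq: "norm x = norm y"
  shows "norm (\<alpha> *\<^sub>R x + \<beta> *\<^sub>R y) = norm (\<beta> *\<^sub>R x + \<alpha> *\<^sub>R y)"
proof -
  let ?c = "x - y"
  consider "x = y" | "\<alpha> + \<beta> = 0" | "x \<noteq> y" "\<alpha> + \<beta> \<noteq> 0" by blast
  then show ?thesis
  proof cases
    case 1
    then show ?thesis by (simp add: add.commute)
  next
    case 2
    then have "\<beta> *\<^sub>R x + \<alpha> *\<^sub>R y = - (\<alpha> *\<^sub>R x + \<beta> *\<^sub>R y)"
      by (simp add: add_eq_0_iff2)
    then show ?thesis by (metis norm_minus_cancel)
  next
    case 3
    have one: "chord_sum y ?c 1"
      using chord_sumI[of 0 1 y ?c] eq by simp
    \<comment> \<open>Were the value at \<open>1 - t\<close> larger, it would be taken at a second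
      point; the sum 1 makes this point \<open>t\<close>, where the value is smaller. Exchanging
      \<open>t\<close> and \<open>1 - t\<close> then yields equality.\<close>
    have le: "norm (y + (1 - t) *\<^sub>R ?c) \<le> norm (y + t *\<^sub>R ?c)" for t
    proof (rule ccontr)
      assume "\<not> ?thesis"
      then have less: "norm (y + t *\<^sub>R ?c) < norm (y + (1 - t) *\<^sub>R ?c)" by simp
      obtain v where v: "v \<noteq> 1 - t" "norm (y + v *\<^sub>R ?c) = norm (y + (1 - t) *\<^sub>R ?c)"
        using chord_through[OF _ less] 3 by auto
      have "v + (1 - t) = 1"
        using unique[OF _ chord_sumI[OF v] one] 3 by simp
      with v less show False by simp
    qed
    have sym: "norm (y + t *\<^sub>R ?c) = norm (y + (1 - t) *\<^sub>R ?c)" for t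
      using le[of t] le[of "1 - t"] by simp
    let ?s = "\<alpha> + \<beta>"
    have "\<alpha> *\<^sub>R x + \<beta> *\<^sub>R y = ?s *\<^sub>R (y + (\<alpha> / ?s) *\<^sub>R ?c)"
      using 3 by (simp add: scaleR_right_distrib) (simp add: algebra_simps)
    moreover have "\<beta> *\<^sub>R x + \<alpha> *\<^sub>R y = ?s *\<^sub>R (y + (\<beta> / ?s) *\<^sub>R ?c)"
      using 3 by (simp add: scaleR_right_distrib) (simp add: algebra_simps)
    moreover have "\<beta> / ?s = 1 - \<alpha> / ?s" using 3 by (simp add: field_simps)
    ultimately show ?thesis using sym[of "\<alpha> / ?s"] by simp
  qed
qed

section \<open>Coordinates in a real plane\<close>

lemma collinear_translate_iff:
  fixes x y z :: "'a::real_vector"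
  shows "collinear {x, y, z} \<longleftrightarrow> collinear {0, y - x, z - x}"
proof -
  have "{x, y, z} = {y, x, z}" by auto
  moreover have "collinear {y, x, z} \<longleftrightarrow> collinear {0, y - x, z - x}"
    by (rule collinear_3) (simp add: NO_MATCH_def)
  ultimately show ?thesis by simp
qed

lemma noncollinear_combination_zero:
  fixes a c :: "'a::real_vector"
  assumes "\<not> collinear {0, a, c}" and "p *\<^sub>R a + q *\<^sub>R c = 0"
  shows "p = 0" "q = 0"
proof -
  have ac: "a \<noteq> 0" "\<And>k. c \<noteq> k *\<^sub>R a" using assms(1) by (auto simp: collinear_lemma)
  show "q = 0"
  proof (rule ccontr)
    assume "q \<noteq> 0"
    have "q *\<^sub>R c = (- p) *\<^sub>R a" using assms(2) by (simp add: eq_neg_iff_add_eq_0 add.commute)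
    then have "(1 / q) *\<^sub>R (q *\<^sub>R c) = (1 / q) *\<^sub>R ((- p) *\<^sub>R a)" by simp
    then have "c = (1 / q * - p) *\<^sub>R a" using \<open>q \<noteq> 0\<close> by simp
    with ac(2) show False by blast
  qed
  with assms(2) ac show "p = 0" by simp
qed

lemma noncollinear_combination_eq:
  fixes a c :: "'a::real_vector"
  assumes "\<not> collinear {0, a, c}" and "p *\<^sub>R a + q *\<^sub>R c = p' *\<^sub>R a + q' *\<^sub>R c"
  shows "p = p' \<and> q = q'"
proof -
  have "(p - p') *\<^sub>R a + (q - q') *\<^sub>R c = 0" using assms(2) by (simp add: algebra_simps)
  from noncollinear_combination_zero[OF assms(1) this] show ?thesis by simp
qed

lemma plane_coordinates:
  fixes a c :: "'a::real_vector"
  assumes dim: "dim (UNIV :: 'a set) = 2" and nc: "\<not> collinear {0, a, c}"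
  obtains p q where "x = p *\<^sub>R a + q *\<^sub>R c"
proof -
  obtain B :: "'a set" where B: "UNIV \<subseteq> span B" "card B = 2"
    using real_vector.basis_exists[of "UNIV :: 'a set"] dim by metis
  \<comment> \<open>An infinite \<open>B\<close> would have cardinality 0 by convention.\<close>
  then have "finite B" using card.infinite by fastforce
  have "\<not> collinear {0, c, a}" using nc by (simp add: insert_commute)
  then have ac: "c \<noteq> 0" "a \<notin> span {c}"
    unfolding collinear_lemma by (auto simp: span_singleton)
  then have "a \<noteq> c" by (auto intro: span_base)
  have "x \<in> span {a, c}"
  proof (rule ccontr)
    assume x: "x \<notin> span {a, c}"
    then have "independent {x, a, c}"
      using ac by (intro independent_insertI) (auto simp: independent_empty)
    then have "card {x, a, c} \<le> card B"
      using independent_span_bound[OF \<open>finite B\<close>] B by blast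
    moreover have "x \<noteq> a" "x \<noteq> c" using x by (auto intro: span_base)
    ultimately show False using \<open>a \<noteq> c\<close> B by simp
  qed
  then obtain p q where "x - p *\<^sub>R a = q *\<^sub>R c"
    by (auto simp: span_breakdown_eq)
  then have "x = p *\<^sub>R a + q *\<^sub>R c" by (simp add: algebra_simps)
  then show thesis by (rule that)
qed

lemma plane_has_noncollinear:
  assumes dim: "dim (UNIV :: 'a::real_vector set) = 2"
  obtains a c :: "'a::real_vector" where "\<not> collinear {0, a, c}"
proof -
  obtain B :: "'a set" where B: "independent B" "card B = 2"
    using real_vector.basis_exists[of "UNIV :: 'a set"] dim by metis
  then obtain a c where ac: "B = {a, c}" "a \<noteq> c" by (auto simp: card_2_iff)
  have "\<not> collinear {0, a, c}"
  proof
    assume "collinear {0, a, c}"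
    moreover have "a \<noteq> 0" "c \<noteq> 0"
      using B ac dependent_zero by blast+
    moreover have "c \<notin> span {a}"
      using B ac by (simp add: insert_commute[of a c] independent_insert)
    ultimately show False by (auto simp: collinear_lemma span_singleton)
  qed
  then show thesis by (rule that)
qed

section \<open>Points of a sphere found by the intermediate value theorem\<close>

text \<open>The claim says that the point of the sphere opposite to \<open>x + y\<close> is
  equidistant from \<open>x\<close> and \<open>y\<close>. Continuity yields some equidistant point
  on the sphere, and \<open>bisect\<close> places it on the line spanned by
  \<open>x + y\<close>.\<close>

lemma equal_chords_extend:
  fixes x y :: "'a::real_normed_vector"
  assumes bisect: "\<And>x y z :: 'a. norm x = norm y \<Longrightarrow> norm z = norm y \<Longrightarrow> norm (z - x) = norm (z - y) \<Longrightarrow>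
      \<not> collinear {x, y, z} \<Longrightarrow> \<exists>k. x + y = k *\<^sub>R z"
    and eq: "norm x = norm y" and nz: "x + y \<noteq> 0"
  shows "norm (x + (norm x / norm (x + y)) *\<^sub>R (x + y)) = norm (y + (norm x / norm (x + y)) *\<^sub>R (x + y))"
proof (cases "collinear {0, x, y}")
  case True
  have "x = y"
  proof -
    have "x \<noteq> 0" "y \<noteq> 0" using eq nz by auto
    then obtain k where k: "y = k *\<^sub>R x" using True by (auto simp: collinear_lemma)
    with eq \<open>x \<noteq> 0\<close> have "\<bar>k\<bar> = 1" by simp
    with k nz show ?thesis by (auto simp: abs_if split: if_splits)
  qed
  then show ?thesis by simp
next
  case False
  have "x \<noteq> y" using False by (metis collinear_2 insert_absorb2)
  have "x \<noteq> 0" using False by auto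
  \<comment> \<open>A path from \<open>x\<close> to \<open>y\<close> that meets the line through \<open>x + y\<close> only on the side opposite to
    \<open>x + y\<close>, so the equidistant point on it is not the obvious multiple of \<open>x + y\<close>.\<close>
  define w where "w u = (1 - u - 4 * u * (1 - u)) *\<^sub>R x + (u - 4 * u * (1 - u)) *\<^sub>R y" for u :: real
  define z where "z u = (norm x / norm (w u)) *\<^sub>R w u" for u
  have w0: "w u \<noteq> 0" for u
  proof
    assume "w u = 0"
    from noncollinear_combination_zero[OF False this[unfolded w_def]]
    have *: "1 - u - 4 * u * (1 - u) = 0" "u - 4 * u * (1 - u) = 0" .
    then have "u = 1 / 2" by linarith
    with * show False by simp
  qed
  have cont: "continuous_on {0..1} (\<lambda>u. norm (z u - x) - norm (z u - y))"
    unfolding z_def w_def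
    by (intro continuous_intros) (use w0 in \<open>auto simp: w_def\<close>)
  have "z 0 = x" "z 1 = y"
    using eq \<open>x \<noteq> 0\<close> by (auto simp: z_def w_def)
  then have "\<exists>u\<ge>0. u \<le> 1 \<and> norm (z u - x) - norm (z u - y) = 0"
    by (intro IVT'[OF _ _ _ cont]) auto
  then obtain u where u: "norm (z u - x) = norm (z u - y)" by auto
  have zn: "norm (z u) = norm y" using w0 eq by (simp add: z_def)
  have "\<exists>k. x + y = k *\<^sub>R z u"
  \<comment> \<open>\<open>bisect\<close> does not cover the collinear case; there the equidistant
    point is the midpoint of \<open>x\<close> and \<open>y\<close>.\<close>
  proof (cases "collinear {x, y, z u}")
    case True
    then have "z u - x = 0 \<or> (\<exists>k. z u - x = k *\<^sub>R (y - x))"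
      using \<open>x \<noteq> y\<close> unfolding collinear_translate_iff[of x] collinear_lemma by simp
    then obtain k where k: "z u - x = k *\<^sub>R (y - x)"
      by (metis scaleR_zero_left)
    then have "z u - y = (k - 1) *\<^sub>R (y - x)" by (simp add: algebra_simps)
    with k u \<open>x \<noteq> y\<close> have "\<bar>k\<bar> = \<bar>k - 1\<bar>" by simp
    then have "2 * k = 1" by linarith
    have "2 *\<^sub>R (z u - x) = (2 * k) *\<^sub>R (y - x)" by (simp add: k)
    then have "x + y = 2 *\<^sub>R z u" unfolding \<open>2 * k = 1\<close>
      by (simp add: algebra_simps scaleR_2)
    then show ?thesis ..
  next
    case False
    show ?thesis by (rule bisect[OF eq zn u False])
  qed
  then obtain k where "x + y = k *\<^sub>R z u" ..
  then obtain m where "x + y = m *\<^sub>R w u" unfolding z_def by auto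
  then have "1 *\<^sub>R x + 1 *\<^sub>R y = (m * (1 - u - 4 * u * (1 - u))) *\<^sub>R x + (m * (u - 4 * u * (1 - u))) *\<^sub>R y"
    by (simp add: w_def scaleR_right_distrib)
  from noncollinear_combination_eq[OF False this]
  have m: "m * (1 - u - 4 * u * (1 - u)) = 1" "m * (u - 4 * u * (1 - u)) = 1" by auto
  then have "m \<noteq> 0" by auto
  \<comment> \<open>The coefficients of \<open>w u\<close> differ by \<open>1 - 2 * u\<close>, so
    they agree only at the middle of the path, where both are \<open>- 1 / 2\<close>.\<close>
  with m have "1 - u - 4 * u * (1 - u) = u - 4 * u * (1 - u)"
    by (metis mult_left_cancel)
  then have "u = 1 / 2" by linarith
  have "w u = (- 1 / 2) *\<^sub>R x + (- 1 / 2) *\<^sub>R y"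
    unfolding w_def \<open>u = 1 / 2\<close> by simp
  then have "w u = (- 1 / 2) *\<^sub>R (x + y)" by (simp add: scaleR_right_distrib)
  then have "z u = - ((norm x / norm (x + y)) *\<^sub>R (x + y))"
    by (simp add: z_def)
  then have "z u - v = - (v + (norm x / norm (x + y)) *\<^sub>R (x + y))" for v by simp
  with u show ?thesis by (simp only: norm_minus_cancel)
qed

text \<open>The equation between \<open>a\<close> and \<open>c\<close> is isosceles orthogonality.
  Along a path of unit vectors \<open>z\<close> from \<open>a\<close> to \<open>- a\<close>, the
  difference \<open>norm (a - z) - norm (a + z)\<close> goes from -2 to 2; a zero of it gives
  \<open>c\<close>.\<close>

lemma square_basis_exists:
  assumes dim: "dim (UNIV :: 'a::real_normed_vector set) = 2"
  obtains a c :: "'a::real_normed_vector" where "norm a = 1" "norm c = 1" "norm (a + c) = norm (a - c)"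
    "\<not> collinear {0, a, c}"
proof -
  obtain b e :: 'a where be: "\<not> collinear {0, b, e}"
    using plane_has_noncollinear[OF dim] by blast
  then have "b \<noteq> 0" by auto
  define a where "a = b /\<^sub>R norm b"
  \<comment> \<open>The two coefficients have no common zero and that of \<open>e\<close> vanishes
    at both ends, so the path avoids 0 and runs from \<open>b\<close> to \<open>- b\<close>.\<close>
  define w where "w u = (1 - 2 * u) *\<^sub>R b + (u * (1 - u)) *\<^sub>R e" for u :: real
  define z where "z u = w u /\<^sub>R norm (w u)" for u
  have a: "norm a = 1" using \<open>b \<noteq> 0\<close> by (simp add: a_def)
  have w0: "w u \<noteq> 0" for u
  proof
    assume "w u = 0"
    from noncollinear_combination_zero[OF be this[unfolded w_def]] show False by auto
  qed
  have cont: "continuous_on {0..1} (\<lambda>u. norm (a - z u) - norm (a + z u))"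
    unfolding z_def w_def
    by (intro continuous_intros) (use w0 in \<open>auto simp: w_def\<close>)
  have "z 0 = a" "z 1 = - a"
    by (auto simp: z_def w_def a_def)
  then have "\<exists>u\<ge>0. u \<le> 1 \<and> norm (a - z u) - norm (a + z u) = 0"
    by (intro IVT'[OF _ _ _ cont]) auto
  then obtain u where u: "norm (a - z u) = norm (a + z u)" by auto
  have zn: "norm (z u) = 1" using w0 by (simp add: z_def)
  have "\<not> collinear {0, a, z u}"
  proof
    assume "collinear {0, a, z u}"
    then obtain k where k: "z u = k *\<^sub>R a"
      using a zn by (auto simp: collinear_lemma)
    have "\<bar>k\<bar> = 1" using k zn a by simp
    then have "z u = a \<or> z u = - a" using k by (auto simp: abs_if split: if_splits)
    then show False using u a by (auto simp flip: scaleR_2)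
  qed
  with a zn u show thesis by (intro that[of a "z u"]) auto
qed

section \<open>The norm in coordinates and its inner product\<close>

text \<open>\<open>Ficken_swap\<close> for \<open>a, c\<close> and for \<open>a + c, a - c\<close>
  allows exchanging the coordinates and changing the sign of one. For a unit vector
  \<open>u = p *\<^sub>R a + q *\<^sub>R c\<close> with nonzero \<open>p\<close> and
  \<open>q\<close>, the line through \<open>a\<close> along \<open>u\<close> then has chords with
  sums \<open>- 2 * p\<close> and \<open>- 2 * p / (p\<^sup>2 + q\<^sup>2)\<close>.\<close>

lemma norm_eq_sqrt_in_square_basis:
  fixes a c :: "'a::real_normed_vector"
  assumes unique: "\<And>(a::'a) c \<sigma> \<tau>. c \<noteq> 0 \<Longrightarrow> chord_sum a c \<sigma> \<Longrightarrow> chord_sum a c \<tau> \<Longrightarrow> \<sigma> = \<tau>"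
    and a: "norm a = 1" and c: "norm c = 1" and ac: "norm (a + c) = norm (a - c)"
  shows "norm (\<alpha> *\<^sub>R a + \<beta> *\<^sub>R c) = sqrt (\<alpha>\<^sup>2 + \<beta>\<^sup>2)"
proof -
  have swap: "norm (p *\<^sub>R x + q *\<^sub>R y) = norm (q *\<^sub>R x + p *\<^sub>R y)"
    if "norm x = norm y" for x y :: 'a and p q
    by (rule Ficken_swap[OF _ that]) (erule (2) unique)
  have swap_ac: "norm (p *\<^sub>R a + q *\<^sub>R c) = norm (q *\<^sub>R a + p *\<^sub>R c)" for p q
    by (rule swap) (simp add: a c)
  have flip_ac: "norm (p *\<^sub>R a + q *\<^sub>R c) = norm (p *\<^sub>R a + (- q) *\<^sub>R c)" for p q
  proof -
    have "((p + q) / 2) *\<^sub>R (a + c) + ((p - q) / 2) *\<^sub>R (a - c)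
        = ((p + q) / 2 + (p - q) / 2) *\<^sub>R a + ((p + q) / 2 - (p - q) / 2) *\<^sub>R c"
      by (simp add: algebra_simps)
    moreover have "((p - q) / 2) *\<^sub>R (a + c) + ((p + q) / 2) *\<^sub>R (a - c)
        = ((p + q) / 2 + (p - q) / 2) *\<^sub>R a + (- ((p + q) / 2 - (p - q) / 2)) *\<^sub>R c"
      by (simp add: algebra_simps)
    moreover have "(p + q) / 2 + (p - q) / 2 = p" "(p + q) / 2 - (p - q) / 2 = q"
      by (simp_all add: field_simps)
    ultimately show ?thesis using swap[OF ac, of "(p + q) / 2" "(p - q) / 2"] by simp
  qed
  have unit: "p\<^sup>2 + q\<^sup>2 = 1" if 1: "norm (p *\<^sub>R a + q *\<^sub>R c) = 1" for p q
  proof (cases "p = 0 \<or> q = 0")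
    case True
    then show ?thesis using that a c by (auto simp: abs_square_eq_1)
  next
    \<comment> \<open>\<open>q \<noteq> 0\<close> makes both chords below nondegenerate, and
      \<open>p \<noteq> 0\<close> allows cancelling the common factor of their sums.\<close>
    case False
    define u where "u = p *\<^sub>R a + q *\<^sub>R c"
    have u: "norm u = norm a" using 1 a by (simp add: u_def)
    have "u \<noteq> 0" using 1 unfolding u_def by auto
    define D where "D = p\<^sup>2 + q\<^sup>2"
    have D: "D > 0" using False by (simp add: D_def sum_power2_gt_zero_iff)
    \<comment> \<open>The parameters are chosen so that exchanging the coefficients of
      \<open>a\<close> and \<open>u\<close> leads to \<open>q *\<^sub>R a + q *\<^sub>R c\<close>
      and its mirror image.\<close>
    have "norm (a + (q - p) *\<^sub>R u) = norm ((q - p) *\<^sub>R a + 1 *\<^sub>R u)"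
      using swap[OF u, of "q - p" 1] by (simp add: add.commute)
    also have "\<dots> = norm (q *\<^sub>R a + q *\<^sub>R c)" by (simp add: u_def algebra_simps)
    also have "\<dots> = norm ((- q) *\<^sub>R a + q *\<^sub>R c)" using flip_ac[of q q] swap_ac by metis
    also have "\<dots> = norm ((- q - p) *\<^sub>R a + 1 *\<^sub>R u)" by (simp add: u_def algebra_simps)
    also have "\<dots> = norm (a + (- q - p) *\<^sub>R u)"
      using swap[OF u, of "- q - p" 1] by (simp add: add.commute)
    finally have s1: "chord_sum a u ((q - p) + (- q - p))"
      using False by (intro chord_sumI) auto
    \<comment> \<open>\<open>v\<close> is \<open>u\<close> turned by a right angle in the basis \<open>a, c\<close>; since it is isosceles
      orthogonal to \<open>u\<close>, the chords of the line \<open>a + \<real> u\<close> are centred on \<open>\<real> v\<close>.\<close>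
    define v where "v = (- q) *\<^sub>R a + p *\<^sub>R c"
    have "norm (v + u) = norm ((p - q) *\<^sub>R a + (p + q) *\<^sub>R c)"
      by (simp add: u_def v_def algebra_simps)
    also have "\<dots> = norm ((p + q) *\<^sub>R a + (- (p - q)) *\<^sub>R c)"
      using swap_ac flip_ac by metis
    also have "\<dots> = norm (- (v - u))"
      by (simp add: u_def v_def algebra_simps)
    finally have vu: "norm (v + u) = norm (v - u)" by (simp only: norm_minus_cancel)
    have "a + ((q - p) / D) *\<^sub>R u = (- q / D) *\<^sub>R (v - u)"
      "a + ((- q - p) / D) *\<^sub>R u = (- q / D) *\<^sub>R (v + u)"
    proof -
      have *: "D *\<^sub>R a = p *\<^sub>R u - q *\<^sub>R v"
        by (simp add: D_def u_def v_def algebra_simps power2_eq_square)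
      have "a = (1 / D) *\<^sub>R (D *\<^sub>R a)" using D by simp
      then have a': "a = (p / D) *\<^sub>R u - (q / D) *\<^sub>R v" unfolding * by (simp add: algebra_simps)
      show "a + ((q - p) / D) *\<^sub>R u = (- q / D) *\<^sub>R (v - u)"
        "a + ((- q - p) / D) *\<^sub>R u = (- q / D) *\<^sub>R (v + u)"
        by (subst a', simp add: algebra_simps diff_divide_distrib)+
    qed
    with vu have "norm (a + ((q - p) / D) *\<^sub>R u) = norm (a + ((- q - p) / D) *\<^sub>R u)"
      by simp
    then have s2: "chord_sum a u ((q - p) / D + (- q - p) / D)"
      using False D by (intro chord_sumI) auto
    have "(q - p) + (- q - p) = (q - p) / D + (- q - p) / D"
      using unique[OF \<open>u \<noteq> 0\<close> s1 s2] .
    then have "D = 1" using False D by (simp add: field_simps)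
    then show ?thesis by (simp add: D_def)
  qed
  define N where "N = norm (\<alpha> *\<^sub>R a + \<beta> *\<^sub>R c)"
  show ?thesis
  proof (cases "N = 0")
    \<comment> \<open>Subtracting the combination with the sign of \<open>\<beta>\<close> changed
      isolates \<open>c\<close>, so no independence of \<open>a\<close> and \<open>c\<close> has to
      be invoked.\<close>
    case True
    have "\<alpha> *\<^sub>R a + \<beta> *\<^sub>R c = 0" using True by (simp add: N_def)
    moreover from this have "\<alpha> *\<^sub>R a + (- \<beta>) *\<^sub>R c = 0" using flip_ac[of \<alpha> \<beta>] by simp
    moreover have "(2 * \<beta>) *\<^sub>R c = (\<alpha> *\<^sub>R a + \<beta> *\<^sub>R c) - (\<alpha> *\<^sub>R a + (- \<beta>) *\<^sub>R c)"
      by (simp flip: scaleR_left_distrib)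
    ultimately have "\<beta> = 0" "\<alpha> *\<^sub>R a + \<beta> *\<^sub>R c = 0" using c by auto
    then show ?thesis using a by auto
  next
    case False
    then have "N > 0" by (simp add: N_def)
    have "(\<alpha> / N) *\<^sub>R a + (\<beta> / N) *\<^sub>R c = (1 / N) *\<^sub>R (\<alpha> *\<^sub>R a + \<beta> *\<^sub>R c)"
      by (simp add: algebra_simps)
    then have "norm ((\<alpha> / N) *\<^sub>R a + (\<beta> / N) *\<^sub>R c) = 1"
      using \<open>N > 0\<close> by (simp add: N_def)
    from unit[OF this] have "\<alpha>\<^sup>2 + \<beta>\<^sup>2 = N\<^sup>2"
      using \<open>N > 0\<close> by (simp add: field_simps)
    then show ?thesis using \<open>N > 0\<close> by (simp add: N_def)
  qed
qed

text \<open>Polarisation defines the form without choosing coordinates; evaluated in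
  \<open>a, c\<close> it is the standard dot product, hence bilinear.\<close>

lemma induced_by_inner_product_if_sqrt:
  fixes a c :: "'a::real_normed_vector"
  assumes span: "\<And>x. \<exists>p q. x = p *\<^sub>R a + q *\<^sub>R c"
    and norm: "\<And>p q. norm (p *\<^sub>R a + q *\<^sub>R c) = sqrt (p\<^sup>2 + q\<^sup>2)"
  shows "induced_by_inner_product (norm :: 'a \<Rightarrow> real)"
proof -
  define B where "B x y = ((norm (x + y))\<^sup>2 - (norm (x - y))\<^sup>2) / 4" for x y :: 'a
  have B: "B (p *\<^sub>R a + q *\<^sub>R c) (p' *\<^sub>R a + q' *\<^sub>R c) = p * p' + q * q'" for p q p' q'
  proof -
    have "(p *\<^sub>R a + q *\<^sub>R c) + (p' *\<^sub>R a + q' *\<^sub>R c) = (p + p') *\<^sub>R a + (q + q') *\<^sub>R c"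
      "(p *\<^sub>R a + q *\<^sub>R c) - (p' *\<^sub>R a + q' *\<^sub>R c) = (p - p') *\<^sub>R a + (q - q') *\<^sub>R c"
      by (simp_all add: algebra_simps)
    then show ?thesis unfolding B_def
      by (simp add: norm) (simp add: power2_eq_square algebra_simps)
  qed
  have sym: "B x y = B y x" for x y by (simp add: B_def add.commute norm_minus_commute)
  have add: "B (x + x') y = B x y + B x' y" for x x' y
  proof -
    obtain p q p' q' r s where
      xy: "x = p *\<^sub>R a + q *\<^sub>R c" "x' = p' *\<^sub>R a + q' *\<^sub>R c" "y = r *\<^sub>R a + s *\<^sub>R c"
      using span by metis
    then have "x + x' = (p + p') *\<^sub>R a + (q + q') *\<^sub>R c" by (simp add: algebra_simps)
    then show ?thesis by (simp only: xy B) (simp add: algebra_simps)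
  qed
  have scale: "B (k *\<^sub>R x) y = k * B x y" for k x y
  proof -
    obtain p q r s where xy: "x = p *\<^sub>R a + q *\<^sub>R c" "y = r *\<^sub>R a + s *\<^sub>R c"
      using span by metis
    then have "k *\<^sub>R x = (k * p) *\<^sub>R a + (k * q) *\<^sub>R c" by (simp add: algebra_simps)
    then show ?thesis by (simp only: xy B) (simp add: algebra_simps)
  qed
  have self: "B x x = (norm x)\<^sup>2" for x
    by (simp add: B_def power_mult_distrib flip: scaleR_2)
  have "bilinear B"
    unfolding bilinear_def by (intro conjI allI linearI) (simp_all add: add scale sym[of _ "_ + _"] sym[of _ "_ *\<^sub>R _"], (metis sym)+)
  then show ?thesis
    unfolding induced_by_inner_product_def is_inner_product_def
    by (intro exI[of _ B]) (use sym self in auto)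
qed

section \<open>Bisectors and orthocentric systems\<close>

text \<open>Sides of equal length are normalised by the same factor, so the bisector points along
  the median direction.\<close>

lemma affine_hull_busemann_bisector:
  fixes p a b :: "'a::real_normed_vector"
  assumes eq: "norm (p - a) = norm (p - b)" and "p \<noteq> a"
  shows "affine hull (busemann_bisector p a b) = {p + t *\<^sub>R ((a - p) + (b - p)) | t. True}"
    (is "?H = ?L")
proof
  define d where "d = (a - p) + (b - p)"
  define k where "k = (1 / 2) / norm (a - p)"
  have "k \<noteq> 0" using \<open>p \<noteq> a\<close> by (simp add: k_def)
  have dir: "(1 / 2) *\<^sub>R ((a - p) /\<^sub>R norm (a - p) + (b - p) /\<^sub>R norm (b - p)) = k *\<^sub>R d"
  proof -
    have "norm (b - p) = norm (a - p)" using eq by (metis norm_minus_commute)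
    then show ?thesis
      by (simp only: k_def d_def scaleR_right_distrib scaleR_scaleR divide_inverse)
  qed
  have ray: "busemann_bisector p a b = {p + (t * k) *\<^sub>R d | t. t \<ge> 0}"
    unfolding busemann_bisector_def dir ray_def by simp
  have aff: "affine ?L"
    unfolding affine_def
  proof safe
    fix u v s t :: real assume "u + v = 1"
    then have "u *\<^sub>R p + v *\<^sub>R p = p" by (metis scaleR_left_distrib scaleR_one)
    then have "u *\<^sub>R (p + s *\<^sub>R (a - p + (b - p))) + v *\<^sub>R (p + t *\<^sub>R (a - p + (b - p))) =
      p + (u * s + v * t) *\<^sub>R (a - p + (b - p))"
      unfolding d_def[symmetric] by (simp add: scaleR_right_distrib scaleR_left_distrib)
    then show "\<exists>r. u *\<^sub>R (p + s *\<^sub>R (a - p + (b - p))) + v *\<^sub>R (p + t *\<^sub>R (a - p + (b - p))) =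
      p + r *\<^sub>R (a - p + (b - p)) \<and> True" by blast
  qed
  show "?H \<subseteq> ?L"
  proof (rule hull_minimal[where S = affine])
    show "busemann_bisector p a b \<subseteq> ?L" by (auto simp: ray d_def)
  qed (rule aff)
  show "?L \<subseteq> ?H"
  proof clarify
    fix t
    have "p \<in> ?H" by (rule hull_inc) (auto simp: ray intro: exI[of _ 0])
    moreover have "p + k *\<^sub>R d \<in> ?H" by (rule hull_inc) (auto simp: ray intro: exI[of _ 1])
    ultimately have "(1 - t / k) *\<^sub>R p + (t / k) *\<^sub>R (p + k *\<^sub>R d) \<in> ?H"
      by (intro mem_affine) auto
    moreover have "(1 - t / k) *\<^sub>R p + (t / k) *\<^sub>R (p + k *\<^sub>R d) = p + t *\<^sub>R d"
      using \<open>k \<noteq> 0\<close> by (simp add: scaleR_right_distrib scaleR_left_diff_distrib)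
    ultimately show "p + t *\<^sub>R (a - p + (b - p)) \<in> ?H" by (simp add: d_def)
  qed
qed

text \<open>For circumcenter 0 the orthocenter of \<open>x, y, z\<close> is
  \<open>x + y + z\<close>. On the bisector line this means that \<open>x + y\<close> is a multiple
  of \<open>x + y - 2 *\<^sub>R z\<close>.\<close>

lemma equidistant_imp_sum_parallel:
  fixes x y z :: "'a::real_normed_vector"
  assumes hyp: "\<And>p :: nat \<Rightarrow> 'a.
       C_orthocentric_system p \<Longrightarrow> \<not> collinear {p 1, p 2, p 3} \<Longrightarrow>
       norm (p 3 - p 1) = norm (p 3 - p 2) \<Longrightarrow>
       p 4 \<in> affine hull (busemann_bisector (p 3) (p 1) (p 2))"
    and n: "norm x = norm y" "norm z = norm y" and eq: "norm (z - x) = norm (z - y)"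
    and nc: "\<not> collinear {x, y, z}"
  shows "\<exists>k. x + y = k *\<^sub>R z"
proof -
  define p where "p i = (if i = 1 then x else if i = 2 then y else if i = 3 then z else x + y + z)"
    for i :: nat
  have p: "p 1 = x" "p 2 = y" "p 3 = z" "p 4 = x + y + z" by (simp_all add: p_def)
  have "0 \<in> circumcenters (p 1) (p 2) (p 3)" "p 4 = C_orthocenter (p 1) (p 2) (p 3) 0"
    unfolding p circumcenters_def C_orthocenter_eq using n by simp_all
  moreover have "{4, 1, 2, 3} = {1, 2, 3, 4 :: nat}" by auto
  ultimately have "C_orthocentric_system p"
    unfolding C_orthocentric_system_def by blast
  then have "x + y + z \<in> affine hull (busemann_bisector z x y)"
    using hyp[of p] nc eq unfolding p by blast
  moreover have "z \<noteq> x" using nc by (metis collinear_2 insert_absorb2 insert_commute)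
  ultimately obtain t where "x + y + z = z + t *\<^sub>R ((x - z) + (y - z))"
    using affine_hull_busemann_bisector[OF eq] by auto
  then have t: "(1 - t) *\<^sub>R (x + y) = (- 2 * t) *\<^sub>R z"
    by (simp add: algebra_simps scaleR_2 flip: scaleR_scaleR)
  \<comment> \<open>Otherwise \<open>z = 0\<close>, the common radius is 0 and the three points
    coincide.\<close>
  have "t \<noteq> 1"
  proof
    assume "t = 1"
    with t have "z = 0" by simp
    with n have "x = 0" "y = 0" by auto
    with nc \<open>z = 0\<close> show False by simp
  qed
  have "x + y = (1 / (1 - t)) *\<^sub>R ((1 - t) *\<^sub>R (x + y))" using \<open>t \<noteq> 1\<close> by simp
  then show ?thesis unfolding t scaleR_scaleR by blast
qed

text \<open>Whichever point is the orthocenter, one of \<open>p 4 - p 3\<close> and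
  \<open>p 1 - p 2\<close> is the sum and the other the difference of two vectors of equal norm,
  joining the circumcenter to two of the points.\<close>

lemma C_orthocentric_system_orthogonal:
  fixes p :: "nat \<Rightarrow> 'a::real_normed_vector"
  assumes B: "is_inner_product B" "\<And>x. norm x = sqrt (B x x)"
    and sys: "C_orthocentric_system p"
  shows "B (p 4 - p 3) (p 1 - p 2) = 0"
proof -
  obtain i j k l x where ijkl: "{i, j, k, l} = {1, 2, 3, 4 :: nat}"
    and x: "x \<in> circumcenters (p j) (p k) (p l)" "p i = C_orthocenter (p j) (p k) (p l) x"
    using sys unfolding C_orthocentric_system_def by blast
  \<comment> \<open>Distinctness of the labels is only implicit in the equality of sets.\<close>
  have "card {i, j, k, l} = 4" unfolding ijkl by simp
  then have dist: "distinct [i, j, k, l]"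
    by (auto simp: card_insert_if split: if_splits)
  have R: "norm (x - p m) = norm (x - p j)" if "m \<in> {1, 2, 3, 4} - {i}" for m
    using that x(1) unfolding ijkl[symmetric] by (auto simp: circumcenters_def)
  \<comment> \<open>Adding \<open>p i\<close> on both sides makes the relation symmetric in the four
    points, so it serves all four cases.\<close>
  have "2 *\<^sub>R p i + 2 *\<^sub>R x = p i + (p i + 2 *\<^sub>R x)" by (simp add: scaleR_2 add.assoc)
  also have "p i + 2 *\<^sub>R x = p j + p k + p l" using x(2) by (simp add: C_orthocenter_eq)
  also have "p i + (p j + p k + p l) = sum p {i, j, k, l}" using dist by (simp add: add.assoc)
  also have "\<dots> = p 1 + p 2 + p 3 + p 4" unfolding ijkl by (simp add: add.assoc)
  finally have S: "2 *\<^sub>R p i + 2 *\<^sub>R x = p 1 + p 2 + p 3 + p 4" .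
  have bil: "bilinear B" and sym: "B y z = B z y" and nn: "B y y \<ge> 0" for y z
    using B(1) by (auto simp: is_inner_product_def bilinear_lzero)
      (metis bilinear_lzero dual_order.refl less_imp_le)
  have orth: "B (y + z) (y - z) = 0" "B (y - z) (y + z) = 0" if "norm y = norm z" for y z
  proof -
    have "B y y = B z z" using that B(2) by simp
    then show "B (y + z) (y - z) = 0"
      using sym[of y z] by (simp add: bilinear_ladd[OF bil] bilinear_rsub[OF bil])
    then show "B (y - z) (y + z) = 0" using sym by simp
  qed
  have flip: "norm (y - x) = norm (x - y)" for y by (rule norm_minus_commute)
  have "i \<in> {1, 2, 3, 4}" using ijkl by blast
  then consider "i = 1" | "i = 2" | "i = 3" | "i = 4" by blast
  then show ?thesis
  proof cases
    case 1
    have "p 4 - p 3 = (p 4 - x) - (p 3 - x)" "p 1 - p 2 = (p 4 - x) + (p 3 - x)"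
      using S 1 by (simp_all add: scaleR_2 algebra_simps)
    then show ?thesis using orth(2)[of "p 4 - x" "p 3 - x"] R[of 4] R[of 3] 1 flip by simp
  next
    case 2
    have "p 4 - p 3 = (x - p 3) - (x - p 4)" "p 1 - p 2 = (x - p 3) + (x - p 4)"
      using S 2 by (simp_all add: scaleR_2 algebra_simps)
    then show ?thesis using orth(2)[of "x - p 3" "x - p 4"] R[of 4] R[of 3] 2 by simp
  next
    case 3
    have "p 4 - p 3 = (x - p 2) + (x - p 1)" "p 1 - p 2 = (x - p 2) - (x - p 1)"
      using S 3 by (simp_all add: scaleR_2 algebra_simps)
    then show ?thesis using orth(1)[of "x - p 2" "x - p 1"] R[of 2] R[of 1] 3 by simp
  next
    case 4
    have "p 4 - p 3 = (p 1 - x) + (p 2 - x)" "p 1 - p 2 = (p 1 - x) - (p 2 - x)"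
      using S 4 by (simp_all add: scaleR_2 algebra_simps)
    then show ?thesis using orth(1)[of "p 1 - x" "p 2 - x"] R[of 2] R[of 1] 4 flip by simp
  qed
qed

theorem theorem3p9:
  assumes "dim (UNIV :: 'a::real_normed_vector set) = 2"
  shows "induced_by_inner_product (norm :: 'a \<Rightarrow> real) \<longleftrightarrow>
    (\<forall>p :: nat \<Rightarrow> 'a.
       C_orthocentric_system p \<longrightarrow> \<not> collinear {p 1, p 2, p 3} \<longrightarrow>
       norm (p 3 - p 1) = norm (p 3 - p 2) \<longrightarrow>
       p 4 \<in> affine hull (busemann_bisector (p 3) (p 1) (p 2)))"
proof
  assume "induced_by_inner_product (norm :: 'a \<Rightarrow> real)"
  then obtain B where B: "is_inner_product B" "\<And>x::'a. norm x = sqrt (B x x)"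
    by (auto simp: induced_by_inner_product_def)
  then have bil: "bilinear B" and sym: "B y z = B z y" for y z
    by (auto simp: is_inner_product_def)
  show "\<forall>p :: nat \<Rightarrow> 'a.
       C_orthocentric_system p \<longrightarrow> \<not> collinear {p 1, p 2, p 3} \<longrightarrow>
       norm (p 3 - p 1) = norm (p 3 - p 2) \<longrightarrow>
       p 4 \<in> affine hull (busemann_bisector (p 3) (p 1) (p 2))"
  proof (intro allI impI)
    fix p :: "nat \<Rightarrow> 'a"
    assume sys: "C_orthocentric_system p" and nc: "\<not> collinear {p 1, p 2, p 3}"
      and eq: "norm (p 3 - p 1) = norm (p 3 - p 2)"
    have "p 3 \<noteq> p 1" using nc by (metis collinear_2 insert_absorb2 insert_commute)
    define u v where "u = p 1 - p 3" and "v = p 2 - p 3"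
    have "\<not> collinear {0, u, v}"
      using nc collinear_translate_iff[of "p 3" "p 1" "p 2"]
      by (simp add: u_def v_def insert_commute)
    then obtain s t where st: "p 4 - p 3 = s *\<^sub>R u + t *\<^sub>R v"
      using plane_coordinates[OF assms] by blast
    have "u \<noteq> v" using nc by (auto simp: u_def v_def)
    have "B u u = B v v" using eq B(2) by (metis norm_minus_commute real_sqrt_eq_iff u_def v_def)
    \<comment> \<open>As \<open>B u u = B v v\<close>, both sides equal
      \<open>2 * (s - t) * (B u u - B u v)\<close>. Orthogonality then forces \<open>s = t\<close>,
      which puts \<open>p 4\<close> on the bisector line.\<close>
    then have "2 * B (p 4 - p 3) (u - v) = (s - t) * B (u - v) (u - v)"
      unfolding st using sym[of v u]
      by (simp add: bilinear_ladd[OF bil] bilinear_rsub[OF bil] bilinear_lsub[OF bil]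
          bilinear_lmul[OF bil] algebra_simps)
    moreover have "u - v = p 1 - p 2" by (simp add: u_def v_def)
    ultimately have "(s - t) * B (u - v) (u - v) = 0"
      using C_orthocentric_system_orthogonal[OF B sys] by simp
    moreover have "B (u - v) (u - v) \<noteq> 0"
      using B(1) \<open>u \<noteq> v\<close> by (simp add: is_inner_product_def) (metis eq_iff_diff_eq_0 less_irrefl)
    ultimately have "s = t" by simp
    with st have "p 4 = p 3 + s *\<^sub>R (u + v)" by (simp add: algebra_simps)
    then show "p 4 \<in> affine hull (busemann_bisector (p 3) (p 1) (p 2))"
      unfolding affine_hull_busemann_bisector[OF eq \<open>p 3 \<noteq> p 1\<close>] u_def v_def by blast
  qed
next
  assume "\<forall>p :: nat \<Rightarrow> 'a.
       C_orthocentric_system p \<longrightarrow> \<not> collinear {p 1, p 2, p 3} \<longrightarrow>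
       norm (p 3 - p 1) = norm (p 3 - p 2) \<longrightarrow>
       p 4 \<in> affine hull (busemann_bisector (p 3) (p 1) (p 2))"
  then have bisect: "\<exists>k. x + y = k *\<^sub>R z"
    if "norm x = norm y" "norm z = norm y" "norm (z - x) = norm (z - y)" "\<not> collinear {x, y, z}"
    for x y z :: 'a
    using equidistant_imp_sum_parallel[OF _ that] by blast
  have extend: "norm (x + (norm x / norm (x + y)) *\<^sub>R (x + y)) = norm (y + (norm x / norm (x + y)) *\<^sub>R (x + y))"
    if "norm x = norm y" "x + y \<noteq> 0" for x y :: 'a
    by (rule equal_chords_extend[OF _ that]) (erule (3) bisect)
  have unique: "\<sigma> = \<tau>" if "c \<noteq> 0" "chord_sum a c \<sigma>" "chord_sum a c \<tau>" for a c :: 'a and \<sigma> \<tau>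
    by (rule chord_sum_unique[OF _ that]) (erule (1) extend)
  obtain a c :: 'a where ac: "norm a = 1" "norm c = 1" "norm (a + c) = norm (a - c)"
    "\<not> collinear {0, a, c}"
    using square_basis_exists[OF assms] by blast
  show "induced_by_inner_product (norm :: 'a \<Rightarrow> real)"
  proof (rule induced_by_inner_product_if_sqrt)
    show "\<exists>p q. x = p *\<^sub>R a + q *\<^sub>R c" for x
      using plane_coordinates[OF assms ac(4)] by metis
    show "norm (p *\<^sub>R a + q *\<^sub>R c) = sqrt (p\<^sup>2 + q\<^sup>2)" for p q
      by (rule norm_eq_sqrt_in_square_basis[OF _ ac(1-3)]) (erule (2) unique)
  qed
qed

end
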